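(* Let $0<q<1$, $\gamma,\xi>-1$, $c>0$ and $n\in\mathbb{N}_0$. Then for $|z|<1$, $$\mathfrak{P}_n^{(\gamma,\xi)}(z,c;q)=\frac{1-q^{c}}{1-q}\int_{0}^{1}(1-qt)_q^{c-1}\,\mathcal{P}_n^{(\gamma,\xi)}(zt;q)\,d_qt .$$
   Context: $(b;q)_0=1$, $(b;q)_k=(1-b)(1-bq)\cdots(1-bq^{k-1})$ for $k\ge1$, $(b;q)_\infty=\prod_{k\ge0}(1-bq^k)$. The little $q$-Jacobi polynomial is $$\mathcal{P}_n^{(\gamma,\xi)}(z;q)={}_2\phi_1\left[{q^{-n},\,q^{n+\gamma+\xi+1}\atop q^{\gamma+1}};q;qz\right]=\sum_{i=0}^{n}\frac{(q^{-n};q)_i(q^{n+\gamma+\xi+1};q)_i}{(q^{\gamma+1};q)_i(q;q)_i}(qz)^i,$$ and the generalized little $q$-Jacobi polynomial is $$\mathfrak{P}_n^{(\gamma,\xi)}(z,c;q)={}_3\phi_2\left[{q^{-n},\,q^{n+\gamma+\xi+1},\,q \atop q^{\gamma+1},\,q^{c+1}};q;qz\right]=\sum_{i=0}^{n}\frac{(q^{-n};q)_i\,(q^{n+\gamma+\xi+1};q)_i}{(q^{\gamma+1};q)_i\,(q^{c+1};q)_i}(qz)^i .$$ The $q$-power is $(x+y)_q^n=\prod_{j=0}^{n-1}(x+q^jy)$ for $n\in\mathbb{N}$, extended to real exponents in the usual way, so that $(1-qt)_q^{c-1}=\dfrac{(qt;q)_\infty}{(q^{c}t;q)_\infty}$.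 The integral is the Jackson $q$-integral $\int_0^1f(t)\,d_qt=(1-q)\sum_{k=0}^\infty q^kf(q^k)$. *)

theory Defs
  imports "HOL-Analysis.Analysis"
begin

definition q_poch :: "real \<Rightarrow> real \<Rightarrow> nat \<Rightarrow> real" where
  "q_poch b q k = (\<Prod>j<k. 1 - b * q ^ j)"

definition q_poch_inf :: "real \<Rightarrow> real \<Rightarrow> real" where
  "q_poch_inf b q = (\<Prod>j. 1 - b * q ^ j)"

text \<open>
  The polynomials have real coefficients; the argument \<open>z\<close> lives in an arbitrary
  real normed field, so that real and complex \<open>z\<close> are both covered.
\<close>

definition little_q_jacobi ::
    "nat \<Rightarrow> real \<Rightarrow> real \<Rightarrow> 'a::real_normed_field \<Rightarrow> real \<Rightarrow> 'a" where
  "little_q_jacobi n \<gamma> \<xi> z q =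
     (\<Sum>i\<le>n. of_real
        (q_poch (q powr (- real n)) q i * q_poch (q powr (real n + \<gamma> + \<xi> + 1)) q i
          / (q_poch (q powr (\<gamma> + 1)) q i * q_poch q q i))
        * (of_real q * z) ^ i)"

definition gen_little_q_jacobi ::
    "nat \<Rightarrow> real \<Rightarrow> real \<Rightarrow> 'a::real_normed_field \<Rightarrow> real \<Rightarrow> real \<Rightarrow> 'a" where
  "gen_little_q_jacobi n \<gamma> \<xi> z c q =
     (\<Sum>i\<le>n. of_real
        (q_poch (q powr (- real n)) q i * q_poch (q powr (real n + \<gamma> + \<xi> + 1)) q i
          / (q_poch (q powr (\<gamma> + 1)) q i * q_poch (q powr (c + 1)) q i))
        * (of_real q * z) ^ i)"

text \<open>
  \<open>q_power q y a\<close> is the \<open>q\<close>-power \<open>(1 + y)\<close> with real exponent \<open>a\<close>, i.e.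
  \<open>\<Prod>j. (1 + q\<^sup>j y) / (1 + q\<^sup>a q\<^sup>j y)\<close>; the lemma below shows that it extends the finite
  product \<open>\<Prod>j<n. (1 + q\<^sup>j y)\<close>.
\<close>

definition q_power :: "real \<Rightarrow> real \<Rightarrow> real \<Rightarrow> real" where
  "q_power q y a = q_poch_inf (- y) q / q_poch_inf (- (q powr a * y)) q"

lemma q_power_of_nat:
  fixes q y :: real and n :: nat
  assumes q: "0 < q" "q < 1" and nz: "\<And>j. 1 + q ^ j * y \<noteq> 0"
  shows "q_power q y (real n) = (\<Prod>j<n. 1 + q ^ j * y)"
proof -
  define f where "f = (\<lambda>j. 1 + q ^ j * y)"
  have f0: "f j \<noteq> 0" for j using nz by (simp add: f_def)
  have "summable (\<lambda>j. norm (f j - 1))"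
    using q by (auto simp: f_def abs_mult intro!: summable_mult2 summable_geometric)
  hence cf: "convergent_prod f"
    by (intro abs_convergent_prod_imp_convergent_prod summable_imp_abs_convergent_prod)
  have num: "q_poch_inf (- y) q = prodinf f"
    by (simp add: q_poch_inf_def f_def mult.commute)
  have den: "q_poch_inf (- (q powr real n * y)) q = (\<Prod>j. f (j + n))"
    using q by (simp add: q_poch_inf_def f_def powr_realpow power_add mult_ac)
  have "prodinf f = (\<Prod>j. f (j + n)) * (\<Prod>j<n. f j)"
    using prodinf_split_initial_segment[OF cf, of n] f0 by (simp add: mult.commute)
  moreover have "(\<Prod>j. f (j + n)) \<noteq> 0"
    using f0 cf by (intro prodinf_nonzero) (auto simp: convergent_prod_iff_shift)
  ultimately show ?thesis
    by (simp add: q_power_def num den) (simp add: f_def)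
qed

definition jackson_integral :: "real \<Rightarrow> (real \<Rightarrow> 'a::real_normed_field) \<Rightarrow> 'a" where
  "jackson_integral q f = of_real (1 - q) * (\<Sum>k. of_real (q ^ k) * f (q ^ k))"

end

theory Submission
  imports Defs
begin

text \<open>
  Expanding \<open>\<P>\<^sub>n(zt)\<close> in powers of \<open>t\<close> reduces the claim to the moments of the weight
  \<open>(1 - qt)\<^sub>q\<^sup>c\<^sup>-\<^sup>1\<close>: integrating \<open>t\<^sup>i\<close> against it, with the factor
  \<open>(1 - q\<^sup>c)/(1 - q)\<close>, has to give \<open>(q;q)\<^sub>i / (q\<^sup>c\<^sup>+\<^sup>1;q)\<^sub>i\<close>, which replaces the
  \<open>(q;q)\<^sub>i\<close> in the denominator of the \<open>i\<close>-th coefficient by \<open>(q\<^sup>c\<^sup>+\<^sup>1;q)\<^sub>i\<close>.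
  This is a \<open>q\<close>-beta integral, and it would follow from the \<open>q\<close>-binomial theorem, but the
  required cases have a shorter proof.

  With \<open>a = q\<^sup>c\<close>, the weight at the node \<open>t = q\<^sup>k\<close> is
  \<open>w\<^sub>k = (q\<^sup>k\<^sup>+\<^sup>1;q)\<^sub>\<infinity> / (a q\<^sup>k;q)\<^sub>\<infinity>\<close>, and dropping the first factor of each product gives
  \<open>(1 - q\<^sup>k\<^sup>+\<^sup>1) w\<^sub>k\<^sub>+\<^sub>1 = (1 - a q\<^sup>k) w\<^sub>k\<close> (\<open>jackson_weight_Suc\<close>). Put
  \<open>v\<^sub>k = (1 - q\<^sup>k) w\<^sub>k\<close>. Then \<open>v\<^sub>k\<^sub>+\<^sub>1 - v\<^sub>k = (1 - a) q\<^sup>k w\<^sub>k\<close>, so the zeroth moment telescopes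
  to \<open>lim v\<^sub>k - v\<^sub>0 = 1\<close>. Summing the same recurrence against \<open>q\<^sup>s\<^sup>(\<^sup>k\<^sup>+\<^sup>1\<^sup>)\<close>, and using
  \<open>v\<^sub>0 = 0\<close> to shift the index on the left, relates consecutive moments
  (\<open>jackson_weight_moment\<close>).
\<close>

section \<open>Infinite q-shifted factorials\<close>

lemma convergent_prod_q_poch:
  fixes b q :: real
  assumes "\<bar>q\<bar> < 1"
  shows "convergent_prod (\<lambda>j. 1 - b * q ^ j)"
proof -
  have "summable (\<lambda>j. norm ((1 - b * q ^ j) - 1))"
    using assms
    by (auto simp: abs_mult power_abs intro!: summable_mult summable_geometric)
  thus ?thesis
    by (intro abs_convergent_prod_imp_convergent_prod summable_imp_abs_convergent_prod)
qed

lemma q_poch_factor_pos: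
  fixes b q :: real
  assumes "0 < q" "q < 1" "b < 1"
  shows "0 < 1 - b * q ^ j"
proof (cases "0 \<le> b")
  case True
  have "b * q ^ j \<le> b * 1"
    using True assms by (intro mult_left_mono power_le_one) auto
  thus ?thesis using assms by simp
next
  case False
  hence "b * q ^ j < 0" using assms by (simp add: mult_neg_pos)
  thus ?thesis by simp
qed

lemma q_poch_pos:
  assumes "0 < q" "q < 1" "b < 1"
  shows "0 < q_poch b q k"
  unfolding q_poch_def using q_poch_factor_pos[OF assms] by (intro prod_pos) simp

lemma q_poch_inf_nonzero:
  assumes "0 < q" "q < 1" "b < 1"
  shows "q_poch_inf b q \<noteq> 0"
  unfolding q_poch_inf_def
proof (rule prodinf_nonzero)
  show "convergent_prod (\<lambda>j. 1 - b * q ^ j)"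
    using assms by (intro convergent_prod_q_poch) simp
  show "\<And>j. 1 - b * q ^ j \<noteq> 0"
    using q_poch_factor_pos[OF assms] by (metis less_irrefl)
qed

lemma q_poch_inf_split:
  assumes "0 < q" "q < 1" "b < 1"
  shows "q_poch_inf b q = q_poch b q k * q_poch_inf (b * q ^ k) q"
proof -
  have cv: "convergent_prod (\<lambda>j. 1 - b * q ^ j)"
    using assms by (intro convergent_prod_q_poch) simp
  have nz: "1 - b * q ^ j \<noteq> 0" for j
    using q_poch_factor_pos[OF assms, of j] by simp
  have "q_poch_inf (b * q ^ k) q = (\<Prod>j. 1 - b * q ^ (j + k))"
    by (simp add: q_poch_inf_def power_add mult_ac)
  thus ?thesis
    using prodinf_split_initial_segment[OF cv nz, of k]
    by (simp add: q_poch_inf_def q_poch_def mult.commute)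
qed

text \<open>
  The tails of a convergent product with nonzero value tend to 1. This provides both the
  boundedness of the weight and the limit of the telescoping sum.
\<close>

lemma q_poch_inf_shift_tendsto_1:
  assumes "0 < q" "q < 1" "b < 1"
  shows "(\<lambda>k. q_poch_inf (b * q ^ k) q) \<longlonglongrightarrow> 1"
proof -
  have cv: "convergent_prod (\<lambda>j. 1 - b * q ^ j)"
    using assms by (intro convergent_prod_q_poch) simp
  have "(\<lambda>k. \<Prod>j\<le>k. 1 - b * q ^ j) \<longlonglongrightarrow> q_poch_inf b q"
    unfolding q_poch_inf_def by (rule convergent_prod_LIMSEQ[OF cv])
  hence "(\<lambda>k. q_poch b q (Suc k)) \<longlonglongrightarrow> q_poch_inf b q"
    by (simp add: q_poch_def lessThan_Suc_atMost)
  hence "(\<lambda>k. q_poch b q k) \<longlonglongrightarrow> q_poch_inf b q"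
    by (rule LIMSEQ_imp_Suc)
  hence "(\<lambda>k. q_poch_inf b q / q_poch b q k) \<longlonglongrightarrow> q_poch_inf b q / q_poch_inf b q"
    using q_poch_inf_nonzero[OF assms] by (intro tendsto_divide tendsto_const)
  moreover have "q_poch_inf b q / q_poch b q k = q_poch_inf (b * q ^ k) q" for k
    using q_poch_inf_split[OF assms, of k] q_poch_pos[OF assms, of k] by simp
  ultimately show ?thesis
    using q_poch_inf_nonzero[OF assms] by simp
qed

lemma q_poch_Suc: "q_poch b q (Suc k) = q_poch b q k * (1 - b * q ^ k)"
  by (simp add: q_poch_def)

section \<open>Moments of the Jackson weight\<close>

text \<open>
  For \<open>a = q\<^sup>c\<close> this is \<open>(1 - qt)\<^sub>q\<^sup>c\<^sup>-\<^sup>1\<close> at \<open>t = q\<^sup>k\<close>; the exponent \<open>c\<close> enters the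
  computation of the moments only through \<open>a\<close>.
\<close>

definition jackson_weight :: "real \<Rightarrow> real \<Rightarrow> nat \<Rightarrow> real" where
  "jackson_weight a q k = q_poch_inf (q * q ^ k) q / q_poch_inf (a * q ^ k) q"

lemma q_power_eq_jackson_weight:
  assumes "0 < q"
  shows "q_power q (- (q * q ^ k)) (c - 1) = jackson_weight (q powr c) q k"
proof -
  have "q powr (c - 1) * q = q powr c"
    using assms by (simp add: powr_diff)
  hence "q powr (c - 1) * (q * q ^ k) = q powr c * q ^ k"
    by (metis mult.assoc)
  thus ?thesis
    by (simp only: q_power_def jackson_weight_def mult_minus_right minus_minus)
qed

context
  fixes a q :: real
  assumes q: "0 < q" "q < 1" and a: "a < 1"
begin

lemma jackson_weight_Suc:
  "(1 - q ^ Suc k) * jackson_weight a q (Suc k) = (1 - a * q ^ k) * jackson_weight a q k"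
proof -
  have less1: "b * q ^ k < 1" if "b < 1" for b
    using q_poch_factor_pos[OF q that, of k] by simp
  have step: "q_poch_inf (b * q ^ k) q = (1 - b * q ^ k) * q_poch_inf (b * q ^ Suc k) q"
    if "b < 1" for b
    using q_poch_inf_split[OF q less1[OF that], of 1] by (simp add: q_poch_def mult_ac)
  have "1 - a * q ^ k \<noteq> 0" using less1[OF a] by simp
  thus ?thesis
    using step[OF a] step[OF q(2)] by (simp add: jackson_weight_def)
qed

lemma jackson_weight_tendsto_1: "jackson_weight a q \<longlonglongrightarrow> 1"
proof -
  have "(\<lambda>k. q_poch_inf (q * q ^ k) q / q_poch_inf (a * q ^ k) q) \<longlonglongrightarrow> 1 / 1"
    by (intro tendsto_divide q_poch_inf_shift_tendsto_1 q a) auto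
  thus ?thesis by (simp add: jackson_weight_def[abs_def])
qed

lemma summable_jackson_weight:
  "summable (\<lambda>k. q ^ (k * Suc i) * jackson_weight a q k)"
proof -
  have "Bseq (jackson_weight a q)"
    using jackson_weight_tendsto_1 by (intro convergent_imp_Bseq convergentI)
  then obtain K where K: "\<And>k. norm (jackson_weight a q k) \<le> K"
    by (auto simp: Bseq_def)
  have "q ^ Suc i < 1" using q power_Suc_less_one by blast
  hence "summable (\<lambda>k. K * (q ^ Suc i) ^ k)"
    using q by (intro summable_mult summable_geometric) simp
  thus ?thesis
  proof (rule summable_comparison_test')
    fix k
    show "norm (q ^ (k * Suc i) * jackson_weight a q k) \<le> K * (q ^ Suc i) ^ k"
      using mult_left_mono[OF K[of k], of "q ^ (k * Suc i)"] q
      by (simp add: abs_mult power_mult[symmetric] mult.commute del: mult_Suc mult_Suc_right power_Suc)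
  qed
qed

lemma jackson_weight_moment_0:
  "(\<lambda>k. (1 - a) * (q ^ k * jackson_weight a q k)) sums 1"
proof -
  let ?v = "\<lambda>k. (1 - q ^ k) * jackson_weight a q k"
  have "(\<lambda>k. q ^ k) \<longlonglongrightarrow> 0" using q by (intro LIMSEQ_power_zero) simp
  hence "?v \<longlonglongrightarrow> (1 - 0) * 1"
    by (intro tendsto_mult tendsto_diff tendsto_const jackson_weight_tendsto_1)
  hence "(\<lambda>k. ?v (Suc k) - ?v k) sums (1 - ?v 0)"
    by (intro telescope_sums) simp
  moreover have "?v (Suc k) - ?v k = (1 - a) * (q ^ k * jackson_weight a q k)" for k
    unfolding jackson_weight_Suc by (simp add: algebra_simps)
  ultimately show ?thesis by simp
qed

text \<open>
  The induction step is the recurrence for the weight multiplied by \<open>q\<^sup>s\<^sup>(\<^sup>k\<^sup>+\<^sup>1\<^sup>)\<close> with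
  \<open>s = i + 1\<close> and summed over \<open>k\<close>: for the moments \<open>F i\<close> it reads
  \<open>F i - F (i+1) = q\<^sup>s (F i - a F (i+1))\<close>.
\<close>

lemma jackson_weight_moment:
  "(\<lambda>k. (1 - a) * (q ^ (k * Suc i) * jackson_weight a q k))
     sums (q_poch q q i / q_poch (a * q) q i)"
proof -
  define F where "F i = (\<Sum>k. q ^ (k * Suc i) * jackson_weight a q k)" for i
  have F: "(\<lambda>k. q ^ (k * Suc i) * jackson_weight a q k) sums F i" for i
    unfolding F_def by (rule summable_sums[OF summable_jackson_weight])
  have factor: "0 < 1 - a * q ^ j" for j
    by (rule q_poch_factor_pos[OF q a])
  have rec: "(1 - q ^ Suc i) * F i = (1 - a * q ^ Suc i) * F (Suc i)" for i
  proof -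
    let ?g = "\<lambda>k. q ^ (k * Suc i) * ((1 - q ^ k) * jackson_weight a q k)"
    have "?g sums (F i - F (Suc i))"
      using sums_diff[OF F[of i] F[of "Suc i"]] by (simp add: algebra_simps power_add)
    hence "(\<lambda>k. ?g (Suc k)) sums (F i - F (Suc i))"
      by (subst sums_Suc_iff) simp
    moreover have "(\<lambda>k. ?g (Suc k)) sums (q ^ Suc i * (F i - a * F (Suc i)))"
    proof -
      have "(\<lambda>k. q ^ Suc i * (q ^ (k * Suc i) * jackson_weight a q k
              - a * (q ^ (k * Suc (Suc i)) * jackson_weight a q k)))
            sums (q ^ Suc i * (F i - a * F (Suc i)))"
        by (intro sums_mult sums_diff F)
      moreover have "?g (Suc k) = q ^ Suc i * (q ^ (k * Suc i) * jackson_weight a q k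
              - a * (q ^ (k * Suc (Suc i)) * jackson_weight a q k))" for k
        unfolding jackson_weight_Suc by (simp add: algebra_simps power_add)
      ultimately show ?thesis by (simp only:)
    qed
    ultimately have "F i - F (Suc i) = q ^ Suc i * (F i - a * F (Suc i))"
      by (rule sums_unique2)
    thus ?thesis by (simp add: algebra_simps)
  qed
  have "(1 - a) * F i = q_poch q q i / q_poch (a * q) q i"
  proof (induction i)
    case 0
    have "(1 - a) * F 0 = 1"
      using sums_unique2[OF sums_mult[OF F[of 0], of "1 - a"]] jackson_weight_moment_0 by simp
    thus ?case by (simp add: q_poch_def)
  next
    case (Suc i)
    have "F (Suc i) = (1 - q ^ Suc i) * F i / (1 - a * q ^ Suc i)"
      using rec[of i] factor[of "Suc i"] by (simp add: eq_divide_eq mult.commute)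
    hence "(1 - a) * F (Suc i) = ((1 - a) * F i) * (1 - q ^ Suc i) / (1 - a * q ^ Suc i)"
      by simp
    also have "\<dots> = q_poch q q (Suc i) / q_poch (a * q) q (Suc i)"
      unfolding Suc.IH by (simp add: q_poch_Suc mult_ac)
    finally show ?case .
  qed
  thus ?thesis using sums_mult[OF F[of i], of "1 - a"] by simp
qed

end

section \<open>The integral representation\<close>

theorem proposition2p1:
  fixes q \<gamma> \<xi> c :: real and n :: nat and z :: "'a::real_normed_field"
  assumes "0 < q" and "q < 1"
    and "\<gamma> > -1" and "\<xi> > -1" and "c > 0"
    and "norm z < 1"
  shows "gen_little_q_jacobi n \<gamma> \<xi> z c q =
    of_real ((1 - q powr c) / (1 - q)) *
      jackson_integral q
        (\<lambda>t. of_real (q_power q (- (q * t)) (c - 1)) * little_q_jacobi n \<gamma> \<xi> (z * of_real t) q)"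
proof -
  define a where "a = q powr c"
  have a: "a < 1" unfolding a_def using assms by (simp add: powr01_less_one)
  have aq: "a * q = q powr (c + 1)" unfolding a_def using assms by (simp add: powr_add)
  define C where "C i = q_poch (q powr (- real n)) q i * q_poch (q powr (real n + \<gamma> + \<xi> + 1)) q i
    / q_poch (q powr (\<gamma> + 1)) q i" for i
  define f where "f t = of_real (q_power q (- (q * t)) (c - 1)) *
    little_q_jacobi n \<gamma> \<xi> (z * of_real t) q" for t
  define m where "m i k = (1 - a) * (q ^ (k * Suc i) * jackson_weight a q k)" for i k
  have summand: "of_real (1 - a) * (of_real (q ^ k) * f (q ^ k)) =
      (\<Sum>i\<le>n. of_real (m i k) * (of_real (C i / q_poch q q i) * (of_real q * z) ^ i))" for k
    unfolding f_def little_q_jacobi_def q_power_eq_jackson_weight[OF assms(1)] a_def[symmetric]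
      sum_distrib_left
    by (intro sum.cong refl)
      (simp add: C_def m_def power_mult_distrib power_add power_mult[symmetric] mult_ac)
  have "(\<lambda>k. of_real (1 - a) * (of_real (q ^ k) * f (q ^ k))) sums
      (\<Sum>i\<le>n. of_real (q_poch q q i / q_poch (a * q) q i) *
        (of_real (C i / q_poch q q i) * (of_real q * z) ^ i))"
    unfolding summand m_def
    by (intro sums_sum sums_mult2 sums_of_real jackson_weight_moment assms(1,2) a)
  also have "(\<Sum>i\<le>n. of_real (q_poch q q i / q_poch (a * q) q i) *
        (of_real (C i / q_poch q q i) * (of_real q * z) ^ i)) = gen_little_q_jacobi n \<gamma> \<xi> z c q"
    unfolding gen_little_q_jacobi_def
  proof (intro sum.cong refl)
    fix i
    have "q_poch q q i \<noteq> 0" using q_poch_pos[OF assms(1,2,2), of i] by simp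
    hence "q_poch q q i / q_poch (a * q) q i * (C i / q_poch q q i)
        = C i / q_poch (q powr (c + 1)) q i"
      unfolding aq by simp
    thus "of_real (q_poch q q i / q_poch (a * q) q i) *
        (of_real (C i / q_poch q q i) * (of_real q * z) ^ i) =
        of_real (q_poch (q powr (- real n)) q i * q_poch (q powr (real n + \<gamma> + \<xi> + 1)) q i
          / (q_poch (q powr (\<gamma> + 1)) q i * q_poch (q powr (c + 1)) q i))
        * (of_real q * z) ^ i"
      by (simp only: mult.assoc[symmetric] of_real_mult[symmetric]) (simp add: C_def)
  qed
  finally have "(\<lambda>k. of_real (1 - a) * (of_real (q ^ k) * f (q ^ k))) sums
    gen_little_q_jacobi n \<gamma> \<xi> z c q" .
  moreover have nz: "(of_real (1 - q) :: 'a) \<noteq> 0" "(of_real (1 - a) :: 'a) \<noteq> 0"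
    using a assms(2) by (simp_all only: of_real_eq_0_iff)
  ultimately have "(\<lambda>k. of_real (q ^ k) * f (q ^ k)) sums
      (gen_little_q_jacobi n \<gamma> \<xi> z c q / of_real (1 - a))"
    using nz sums_divide[of "\<lambda>k. of_real (1 - a) * (of_real (q ^ k) * f (q ^ k))" _
        "of_real (1 - a)"]
    by (simp del: of_real_diff)
  hence "(\<Sum>k. of_real (q ^ k) * f (q ^ k)) = gen_little_q_jacobi n \<gamma> \<xi> z c q / of_real (1 - a)"
    by (rule sums_unique[symmetric])
  moreover have "of_real ((1 - a) / (1 - q)) * (of_real (1 - q) * (x / of_real (1 - a))) = x"
    for x :: 'a
    using nz by (simp add: of_real_divide del: of_real_diff)
  ultimately show ?thesis
    unfolding jackson_integral_def a_def[symmetric] f_def[symmetric] by simp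
qed

end
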